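(* Let $n\ge1$ and let $\alpha_1,\dots,\alpha_n,\beta_1,\dots,\beta_{n-1}$ be rational numbers, with no $\beta_k$ a non-positive integer, and let $A_m$ denote the $m$-th coefficient of \[ {}_nF_{n-1}(\alpha_1,\dots,\alpha_n;\beta_1,\dots,\beta_{n-1};z)=\sum_{m\ge0}\frac{\prod_{j=1}^n(\alpha_j)_m}{\prod_{k=1}^{n-1}(\beta_k)_m}\frac{z^m}{m!}. \] Let $p$ be a prime such that $v_p(\alpha_j-1)\ge0$ and $v_p(\beta_k-1)\ge0$ for all $j,k$. Then for all $m\ge0$, \[ v_p(A_m)=\sum_{j=1}^n c_p(\alpha_j-1,m)-\sum_{k=1}^{n-1}c_p(\beta_k-1,m). \] Further, assume that the parameters $(\alpha_1,\dots,\alpha_n;\beta_1,\dots,\beta_{n-1})$ are admissible, that $p$ is a good prime for them, and let $M$ be the corresponding period. Then $v_p(A_{mp^M})=v_p(A_m)$ for all integers $m\ge0$.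
   Context: $(a)_0=1$ and $(a)_m=a(a+1)\cdots(a+m-1)$ for $m\ge1$. $v_p$ is the $p$-adic valuation with $v_p(p)=1$ (and $v_p(0)=\infty$). For $p$-adic integers $a,b$, $c_p(a,b)\in\mathbb{N}\cup\{\infty\}$ denotes the number of carries occurring when computing the sum $a+b$ digit by digit in base $p$ using their $p$-adic expansions. Rational parameters $(\alpha_1,\dots,\alpha_n;\beta_1,\dots,\beta_{n-1})$ are admissible if $0<\alpha_j,\beta_k<1$ for all $j,k$ and $\alpha_j\ne\beta_k$ for all $j,k$. A prime $p$ is good for these parameters if $v_p(\alpha_j-1)=v_p(\beta_k-1)=0$ for all $j,k$. For a good prime $p$, the period is the least common multiple of the multiplicative orders of $p$ modulo the reduced denominators of the numbers $\alpha_j-1$ and $\beta_k-1$. *)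

theory Defs
  imports
    Complex_Main
    "HOL-Library.Extended_Real"
    "HOL-Library.Nonpos_Ints"
    "HOL-Computational_Algebra.Computational_Algebra"
    "HOL-Number_Theory.Number_Theory"
begin

definition padic_val :: "nat \<Rightarrow> rat \<Rightarrow> ereal" where
  "padic_val p x =
     (if x = 0 then \<infinity>
      else ereal (real (multiplicity (int p) (fst (quotient_of x)))
                  - real (multiplicity (int p) (snd (quotient_of x)))))"

text \<open>
  A sequence \<open>d\<close> of digits in \<open>{0..<p}\<close> stands for the \<open>p\<close>-adic integer \<open>\<Sum>i. d i * p ^ i\<close>.
  The rational \<open>x\<close> has expansion \<open>d\<close> if the partial sums converge to \<open>x\<close> in the \<open>p\<close>-adic metric.
  For \<open>p\<close> prime, such a \<open>d\<close> exists (and is then unique) exactly when \<open>padic_val p x \<ge> 0\<close>.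
\<close>

definition is_padic_expansion :: "nat \<Rightarrow> rat \<Rightarrow> (nat \<Rightarrow> nat) \<Rightarrow> bool" where
  "is_padic_expansion p x d \<longleftrightarrow>
     (\<forall>i. d i < p) \<and>
     (\<lambda>N. padic_val p (x - (\<Sum>i<N. of_nat (d i) * of_nat p ^ i))) \<longlonglongrightarrow> \<infinity>"

definition padic_digits :: "nat \<Rightarrow> rat \<Rightarrow> nat \<Rightarrow> nat" where
  "padic_digits p x = (THE d. is_padic_expansion p x d)"

text \<open>\<open>carry p d e i\<close> is the carry into position \<open>i\<close> when adding \<open>d\<close> and \<open>e\<close> in base \<open>p\<close>.\<close>

primrec carry :: "nat \<Rightarrow> (nat \<Rightarrow> nat) \<Rightarrow> (nat \<Rightarrow> nat) \<Rightarrow> nat \<Rightarrow> nat" where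
  "carry p d e 0 = 0"
| "carry p d e (Suc i) = (if d i + e i + carry p d e i \<ge> p then 1 else 0)"

definition num_carries :: "nat \<Rightarrow> (nat \<Rightarrow> nat) \<Rightarrow> (nat \<Rightarrow> nat) \<Rightarrow> enat" where
  "num_carries p d e =
     (if finite {i. carry p d e i = 1} then enat (card {i. carry p d e i = 1}) else \<infinity>)"

definition c_p :: "nat \<Rightarrow> rat \<Rightarrow> rat \<Rightarrow> enat" where
  "c_p p a b = num_carries p (padic_digits p a) (padic_digits p b)"

definition admissible :: "rat list \<Rightarrow> rat list \<Rightarrow> bool" where
  "admissible \<alpha> \<beta> \<longleftrightarrow>
     (\<forall>a\<in>set \<alpha>. 0 < a \<and> a < 1) \<and> (\<forall>b\<in>set \<beta>. 0 < b \<and> b < 1) \<and>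
     (\<forall>a\<in>set \<alpha>. \<forall>b\<in>set \<beta>. a \<noteq> b)"

definition good_prime :: "nat \<Rightarrow> rat list \<Rightarrow> rat list \<Rightarrow> bool" where
  "good_prime p \<alpha> \<beta> \<longleftrightarrow>
     prime p \<and> (\<forall>a\<in>set \<alpha>. padic_val p (a - 1) = 0) \<and> (\<forall>b\<in>set \<beta>. padic_val p (b - 1) = 0)"

definition denom :: "rat \<Rightarrow> nat" where
  "denom x = nat (snd (quotient_of x))"

definition period :: "nat \<Rightarrow> rat list \<Rightarrow> rat list \<Rightarrow> nat" where
  "period p \<alpha> \<beta> = Lcm ((\<lambda>x. ord (denom (x - 1)) p) ` (set \<alpha> \<union> set \<beta>))"

text \<open>The argument \<open>1\<close> is the scaling \<open>c\<close> in the library's series in \<open>c * z\<close>.\<close>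

definition hypergeo_coeff :: "rat list \<Rightarrow> rat list \<Rightarrow> nat \<Rightarrow> rat" where
  "hypergeo_coeff \<alpha> \<beta> m = fps_nth (fps_hypergeo \<alpha> \<beta> 1) m"

end

theory Submission
  imports Defs
begin

text \<open>
  Write \<open>x\<^sub>N\<close> for the residue of a \<open>p\<close>-adic integer \<open>x\<close> in \<open>{0..<p ^ N}\<close>. Counting the \<open>i \<in> {1..m}\<close>
  with \<open>p ^ N\<close> dividing \<open>x + i\<close> gives \<open>v\<^sub>p((x + 1)\<^sub>m) = \<Sum>N\<ge>1. (x\<^sub>N + m) div p ^ N\<close>. Subtracting the case
  \<open>x = 0\<close>, which is \<open>v\<^sub>p(m!)\<close>, leaves in each summand exactly the carry into position \<open>N\<close> of \<open>x + m\<close>,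
  so \<open>v\<^sub>p((x + 1)\<^sub>m / m!) = c\<^sub>p(x, m)\<close>; both sides are infinite iff \<open>x\<close> is one of \<open>-1, \<dots>, -m\<close>.
  If \<open>-1 < x < 0\<close>, the digits of \<open>x\<close> are purely periodic with period \<open>M\<close>, and multiplying \<open>m\<close> by
  \<open>p ^ M\<close> shifts all carries by \<open>M\<close> places.
\<close>

section \<open>The valuation on the rationals\<close>

lemma padic_val_0 [simp]: "padic_val p 0 = \<infinity>"
  by (simp add: padic_val_def)

lemma padic_val_neq_minus_infinity [simp]: "padic_val p x \<noteq> -\<infinity>"
  by (simp add: padic_val_def)

lemma padic_val_eq_infinity_iff [simp]: "padic_val p x = \<infinity> \<longleftrightarrow> x = 0"
  by (simp add: padic_val_def)

text \<open>Cross-multiplying with the reduced fraction shows that the difference of multiplicities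
  is the same for every representing fraction. Later computations therefore never have to
  reduce.\<close>

lemma padic_val_of_int_divide:
  assumes "prime p" "a \<noteq> 0" "b \<noteq> 0"
  shows "padic_val p (of_int a / of_int b) =
           ereal (real (multiplicity (int p) a) - real (multiplicity (int p) b))"
proof -
  obtain c d where cd: "quotient_of (of_int a / of_int b) = (c, d)"
    by (cases "quotient_of (of_int a / of_int b)")
  have d: "d > 0" using quotient_of_denom_pos[OF cd] .
  have eq: "(of_int a / of_int b :: rat) = of_int c / of_int d" using quotient_of_div[OF cd] .
  then have "of_int (a * d) = (of_int (c * b) :: rat)"
    using assms d by (simp add: field_simps)
  then have ad: "a * d = c * b" by (simp only: of_int_eq_iff)
  then have c: "c \<noteq> 0" using assms d by auto
  have "prime_elem (int p)" using assms(1) by simp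
  then have "multiplicity (int p) a + multiplicity (int p) d =
      multiplicity (int p) c + multiplicity (int p) b"
    using ad assms d c
    by (metis prime_elem_multiplicity_mult_distrib less_irrefl)
  then show ?thesis using assms cd by (simp add: padic_val_def)
qed

lemma padic_val_mult:
  assumes "prime p"
  shows "padic_val p (x * y) = padic_val p x + padic_val p y"
proof (cases "x = 0 \<or> y = 0")
  case True
  then show ?thesis by auto
next
  case False
  obtain a b where ab: "quotient_of x = (a, b)" by (cases "quotient_of x")
  obtain c d where cd: "quotient_of y = (c, d)" by (cases "quotient_of y")
  note [simp] = quotient_of_div[OF ab] quotient_of_div[OF cd]
  have bd: "b > 0" "d > 0" using ab cd quotient_of_denom_pos by auto
  have ac: "a \<noteq> 0" "c \<noteq> 0" using False by auto
  have pe: "prime_elem (int p)" using assms by simp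
  show ?thesis
    using padic_val_of_int_divide[OF assms, of a b] padic_val_of_int_divide[OF assms, of c d]
      padic_val_of_int_divide[OF assms, of "a * c" "b * d"] bd ac
      prime_elem_multiplicity_mult_distrib[OF pe, of a c]
      prime_elem_multiplicity_mult_distrib[OF pe, of b d]
    by simp
qed

lemma padic_val_1 [simp]: "padic_val p 1 = 0"
  by (simp add: padic_val_def zero_ereal_def)

lemma padic_val_divide:
  assumes "prime p" "y \<noteq> 0"
  shows "padic_val p (x / y) = padic_val p x - padic_val p y"
proof -
  have "padic_val p x = padic_val p (x / y) + padic_val p y"
    using assms padic_val_mult[of p "x / y" y] by simp
  then show ?thesis
    using assms(2) padic_val_eq_infinity_iff[of p y]
    by (cases "padic_val p (x / y)"; cases "padic_val p y") auto
qed

lemma padic_val_prod: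
  assumes "prime p"
  shows "padic_val p (\<Prod>i\<in>A. f i) = (\<Sum>i\<in>A. padic_val p (f i))"
  by (induction A rule: infinite_finite_induct) (simp_all add: padic_val_mult assms)

text \<open>Algebraic form of a lower bound on the valuation: it survives passing to a common
  denominator prime to \<open>p\<close> and includes zero through \<open>a = 0\<close>. The
  ultrametric inequality then needs no minimum and no case split.\<close>

lemma padic_val_ge_iff:
  assumes p: "prime p"
  shows "padic_val p x \<ge> ereal (real N) \<longleftrightarrow>
    (\<exists>a b. \<not> int p dvd b \<and> x = of_int (int p ^ N * a) / of_int b)"
proof
  have pe: "prime_elem (int p)" using p by simp
  assume L: "padic_val p x \<ge> ereal (real N)"
  show "\<exists>a b. \<not> int p dvd b \<and> x = of_int (int p ^ N * a) / of_int b"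
  proof (cases "x = 0")
    case True
    then show ?thesis using p
      by (intro exI[of _ 0] exI[of _ 1]) (auto dest: prime_gt_1_nat)
  next
    case False
    obtain a b where ab: "quotient_of x = (a, b)" by (cases "quotient_of x")
    note x = quotient_of_div[OF ab]
    have b: "b > 0" and cop: "coprime a b"
      using ab quotient_of_denom_pos quotient_of_coprime by auto
    have a: "a \<noteq> 0" using False x by auto
    have le: "real N \<le> real (multiplicity (int p) a) - real (multiplicity (int p) b)"
      using L False ab by (simp add: padic_val_def)
    \<comment> \<open>In a reduced fraction, \<open>p\<close> dividing \<open>b\<close> would make
      the valuation negative.\<close>
    have nb: "\<not> int p dvd b"
    proof
      assume *: "int p dvd b"
      have "\<not> int p dvd a"
        using * cop pe by (meson coprime_common_divisor prime_elem_def)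
      then have "multiplicity (int p) a = 0" by (simp add: not_dvd_imp_multiplicity_0)
      moreover have "multiplicity (int p) b > 0"
        using * b pe by (simp add: prime_multiplicity_gt_zero_iff)
      ultimately show False using le by simp
    qed
    then have "multiplicity (int p) b = 0" by (simp add: not_dvd_imp_multiplicity_0)
    then have "N \<le> multiplicity (int p) a" using le by simp
    then have "int p ^ N dvd a" by (rule multiplicity_dvd')
    then obtain c where "a = int p ^ N * c" by (elim dvdE)
    then show ?thesis using nb x by blast
  qed
next
  have pe: "prime_elem (int p)" using p by simp
  assume "\<exists>a b. \<not> int p dvd b \<and> x = of_int (int p ^ N * a) / of_int b"
  then obtain a b where nb: "\<not> int p dvd b" and x: "x = of_int (int p ^ N * a) / of_int b"
    by blast
  show "padic_val p x \<ge> ereal (real N)"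
  proof (cases "a = 0")
    case False
    have b: "b \<noteq> 0" using nb by auto
    have p0: "int p \<noteq> 0" using pe by auto
    have "multiplicity (int p) (int p ^ N * a) = N + multiplicity (int p) a"
      using False pe p0
      by (simp add: prime_elem_multiplicity_mult_distrib)
    then show ?thesis
      using padic_val_of_int_divide[OF p, of "int p ^ N * a" b] False b p0 nb x
      by (simp add: not_dvd_imp_multiplicity_0)
  qed (simp add: x)
qed

lemma padic_val_ge_of_int_iff:
  assumes p: "prime p"
  shows "padic_val p (of_int a) \<ge> ereal (real N) \<longleftrightarrow> int p ^ N dvd a"
proof (cases "a = 0")
  case False
  have "\<not> is_unit (int p)" using p by (auto dest: prime_gt_1_nat)
  then show ?thesis
    using padic_val_of_int_divide[OF p False, of 1] False
    by (simp add: power_dvd_iff_le_multiplicity)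
qed auto

lemma padic_val_ge_add:
  assumes p: "prime p" and "padic_val p x \<ge> ereal (real N)" "padic_val p y \<ge> ereal (real N)"
  shows "padic_val p (x + y) \<ge> ereal (real N)"
proof -
  obtain a b c d where
    nb: "\<not> int p dvd b" and x: "x = of_int (int p ^ N * a) / of_int b" and
    nd: "\<not> int p dvd d" and y: "y = of_int (int p ^ N * c) / of_int d"
    using assms unfolding padic_val_ge_iff[OF p] by blast
  have "b \<noteq> 0" "d \<noteq> 0" using nb nd by auto
  then have "x + y = of_int (int p ^ N * (a * d + c * b)) / of_int (b * d)"
    unfolding x y by (simp add: field_simps)
  moreover have "\<not> int p dvd b * d" using p nb nd by (simp add: prime_dvd_mult_iff)
  ultimately show ?thesis unfolding padic_val_ge_iff[OF p] by blast
qed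

lemma padic_val_minus: "padic_val p (- x) = padic_val p x"
proof -
  have "quotient_of (- x) = (- fst (quotient_of x), snd (quotient_of x))"
    by (simp add: rat_uminus_code split: prod.split)
  then show ?thesis by (simp add: padic_val_def)
qed

lemma padic_val_ge_diff:
  assumes "prime p" "padic_val p x \<ge> ereal (real N)" "padic_val p y \<ge> ereal (real N)"
  shows "padic_val p (x - y) \<ge> ereal (real N)"
  using padic_val_ge_add[of p N x "- y"] assms by (simp add: padic_val_minus)

lemma padic_val_ge_cong:
  assumes "prime p" "padic_val p (x - y) \<ge> ereal (real N)"
  shows "padic_val p x \<ge> ereal (real N) \<longleftrightarrow> padic_val p y \<ge> ereal (real N)"
  using padic_val_ge_add[OF assms(1,2), of y] padic_val_ge_diff[OF assms(1) _ assms(2), of x]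
  by auto

lemma padic_val_of_nat_power:
  assumes "prime p"
  shows "padic_val p (of_nat p ^ N) = ereal (real N)"
proof -
  have "prime_elem (int p)" using assms by simp
  then show ?thesis
    using padic_val_of_int_divide[OF assms, of "int p ^ N" 1] assms
    by (auto simp: prime_gt_0_nat)
qed

section \<open>Truncations and digits\<close>

lemma digit_sum_less:
  fixes d :: "nat \<Rightarrow> nat"
  assumes "\<And>i. d i < p"
  shows "(\<Sum>i<N. d i * p ^ i) < p ^ N"
proof (induction N)
  case (Suc N)
  have "(\<Sum>i<Suc N. d i * p ^ i) < p ^ N + d N * p ^ N" using Suc by simp
  also have "\<dots> = Suc (d N) * p ^ N" by simp
  also have "\<dots> \<le> p * p ^ N" using assms[of N] by (intro mult_right_mono) auto
  finally show ?case by simp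
qed simp

lemma digit_sum_mod:
  fixes d :: "nat \<Rightarrow> nat"
  assumes "\<And>i. d i < p" "N \<le> M"
  shows "(\<Sum>i<M. d i * p ^ i) mod p ^ N = (\<Sum>i<N. d i * p ^ i)"
  using assms(2)
proof (induction M rule: dec_induct)
  case base
  show ?case using digit_sum_less[of d p N] assms(1) by simp
next
  case (step M)
  have "p ^ N dvd d M * p ^ M" using step by (simp add: le_imp_power_dvd)
  then have "(\<Sum>i<Suc M. d i * p ^ i) mod p ^ N = (\<Sum>i<M. d i * p ^ i) mod p ^ N"
    by (auto elim!: dvdE)
  then show ?case using step by simp
qed

section \<open>Residues modulo \<open>p ^ N\<close>, existence and uniqueness of digits\<close>

lemma padic_residue_exists:
  assumes p: "prime p" and x: "padic_val p x \<ge> 0"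
  shows "\<exists>k<p ^ N. padic_val p (x - of_nat k) \<ge> ereal (real N)"
proof -
  obtain a b where nb: "\<not> int p dvd b" and xab: "x = of_int a / of_int b"
    using x padic_val_ge_iff[OF p, of 0 x] by (auto simp: zero_ereal_def)
  have "coprime (int p) b" using p nb by (simp add: prime_imp_coprime)
  then have "coprime b (int p ^ N)" by (simp add: coprime_commute)
  \<comment> \<open>Inverting the denominator \<open>b\<close> modulo \<open>p ^ N\<close> makes
    \<open>a * c\<close> congruent to \<open>a / b\<close>.\<close>
  then obtain c where c: "[b * c = 1] (mod int p ^ N)" using cong_solve_coprime_int by blast
  define k where "k = (a * c) mod int p ^ N"
  have pN: "int p ^ N > 0" using p by (simp add: prime_gt_0_nat)
  have k: "0 \<le> k" "k < int p ^ N" using pN by (simp_all add: k_def)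
  have "[b * k = b * (a * c)] (mod int p ^ N)"
    unfolding k_def by (intro cong_mult) (simp_all add: cong_def)
  also have "b * (a * c) = a * (b * c)" by simp
  also have "[a * (b * c) = a * 1] (mod int p ^ N)" by (intro cong_mult c) simp
  finally have "int p ^ N dvd a - b * k"
    by (simp add: cong_iff_dvd_diff dvd_diff_commute)
  then obtain e where "a - b * k = int p ^ N * e" by (elim dvdE)
  moreover have "b \<noteq> 0" using nb by auto
  then have "x - of_nat (nat k) = of_int (a - b * k) / of_int b"
    using k by (simp add: xab diff_divide_distrib)
  ultimately have "padic_val p (x - of_nat (nat k)) \<ge> ereal (real N)"
    using nb padic_val_ge_iff[OF p] by metis
  moreover have "nat k < p ^ N" using k by (simp add: nat_less_iff)
  ultimately show ?thesis by blast
qed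

lemma padic_residue_unique:
  assumes p: "prime p" and "k < p ^ N" "l < p ^ N"
    and "padic_val p (x - of_nat k) \<ge> ereal (real N)" "padic_val p (x - of_nat l) \<ge> ereal (real N)"
  shows "k = l"
proof -
  have "padic_val p ((x - of_nat k) - (x - of_nat l)) \<ge> ereal (real N)"
    using padic_val_ge_diff[OF p assms(4,5)] .
  also have "(x - of_nat k) - (x - of_nat l) = of_int (int l - int k)" by simp
  finally have "int p ^ N dvd int l - int k" by (simp only: padic_val_ge_of_int_iff[OF p])
  then have "int l mod int p ^ N = int k mod int p ^ N" by (simp add: mod_eq_dvd_iff)
  then have "int (l mod p ^ N) = int (k mod p ^ N)" by (simp add: zmod_int)
  then show ?thesis using assms by simp
qed

text \<open>Convergence only bounds the error of late partial sums. A late one agrees with the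
  \<open>N\<close>-th modulo \<open>p ^ N\<close>, which carries the bound back to every
  \<open>N\<close> and replaces the limit by congruences.\<close>

lemma is_padic_expansion_iff:
  assumes p: "prime p"
  shows "is_padic_expansion p x d \<longleftrightarrow>
    (\<forall>i. d i < p) \<and> (\<forall>N. padic_val p (x - of_nat (\<Sum>i<N. d i * p ^ i)) \<ge> ereal (real N))"
proof -
  let ?S = "\<lambda>N. \<Sum>i<N. d i * p ^ i"
  have S: "(\<Sum>i<N. of_nat (d i) * of_nat p ^ i) = (of_nat (?S N) :: rat)" for N by simp
  have "(\<forall>N. padic_val p (x - of_nat (?S N)) \<ge> ereal (real N)) \<longleftrightarrow>
      (\<lambda>N. padic_val p (x - of_nat (?S N))) \<longlonglongrightarrow> \<infinity>" (is "?L \<longleftrightarrow> ?R") if d: "\<And>i. d i < p"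
  proof
    assume L: ?L
    show ?R unfolding tendsto_PInfty
    proof
      fix r :: real
      obtain M :: nat where M: "r < real M" using reals_Archimedean2 by blast
      show "\<forall>\<^sub>F N in sequentially. ereal r < padic_val p (x - of_nat (?S N))"
      proof (rule eventually_sequentiallyI)
        fix N assume "M \<le> N"
        then have "ereal r < ereal (real N)" using M by simp
        also have "\<dots> \<le> padic_val p (x - of_nat (?S N))" using L by blast
        finally show "ereal r < padic_val p (x - of_nat (?S N))" .
      qed
    qed
  next
    assume R: ?R
    show ?L
    proof
      fix N
      have "\<forall>\<^sub>F M in sequentially. ereal (real N) < padic_val p (x - of_nat (?S M))"
        using R unfolding tendsto_PInfty by blast
      then obtain M0 where
        M0: "\<And>M. M \<ge> M0 \<Longrightarrow> ereal (real N) < padic_val p (x - of_nat (?S M))"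
        unfolding eventually_sequentially by blast
      define M where "M = max M0 N"
      have "padic_val p (x - of_nat (?S M)) \<ge> ereal (real N)"
        using M0[of M] by (simp add: M_def)
      moreover have "padic_val p (of_int (int (?S M) - int (?S N))) \<ge> ereal (real N)"
      proof (subst padic_val_ge_of_int_iff[OF p])
        have "?S M mod p ^ N = ?S N mod p ^ N"
          using digit_sum_mod[of d p N M, OF d] digit_sum_mod[of d p N N, OF d] by (simp add: M_def)
        then have "int (?S M) mod int p ^ N = int (?S N) mod int p ^ N"
          by (metis of_nat_mod of_nat_power)
        then show "int p ^ N dvd int (?S M) - int (?S N)" by (simp add: mod_eq_dvd_iff)
      qed
      ultimately have "padic_val p ((x - of_nat (?S M)) + of_int (int (?S M) - int (?S N)))
          \<ge> ereal (real N)"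
        by (intro padic_val_ge_add p)
      moreover have "(x - of_nat (?S M)) + of_int (int (?S M) - int (?S N)) = x - of_nat (?S N)"
        by (simp only: of_int_diff of_int_of_nat_eq)
      ultimately show "padic_val p (x - of_nat (?S N)) \<ge> ereal (real N)" by simp
    qed
  qed
  then show ?thesis unfolding is_padic_expansion_def S by blast
qed

text \<open>Justifies the definite description in \<open>padic_digits\<close>. The residues modulo
  the powers of \<open>p\<close> exist, are unique and are compatible; successive digits are read
  off from them.\<close>

lemma is_padic_expansion_padic_digits:
  assumes p: "prime p" and x: "padic_val p x \<ge> 0"
  shows "is_padic_expansion p x (padic_digits p x)"
proof -
  have p0: "p > 0" using p by (rule prime_gt_0_nat)
  obtain r where r: "\<And>N. r N < p ^ N" "\<And>N. padic_val p (x - of_nat (r N)) \<ge> ereal (real N)"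
    using padic_residue_exists[OF p x] by metis
  \<comment> \<open>The leading one of the \<open>N + 1\<close> base-\<open>p\<close> digits of
    \<open>r (Suc N)\<close>.\<close>
  define d where "d N = r (Suc N) div p ^ N" for N
  \<comment> \<open>Precision \<open>N + 1\<close> implies precision \<open>N\<close>, so uniqueness
    of residues forces compatibility.\<close>
  have r_mod: "r (Suc N) mod p ^ N = r N" for N
  proof (rule padic_residue_unique[OF p])
    let ?k = "r (Suc N)"
    have "padic_val p (x - of_nat ?k) \<ge> ereal (real N)"
      using order_trans[OF _ r(2)[of "Suc N"], of "ereal (real N)"] by simp
    moreover have "padic_val p (of_int (int ?k - int (?k mod p ^ N))) \<ge> ereal (real N)"
      by (subst padic_val_ge_of_int_iff[OF p])
         (metis dvd_minus_mod of_nat_diff of_nat_dvd_iff of_nat_power mod_less_eq_dividend)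
    ultimately have "padic_val p ((x - of_nat ?k) + of_int (int ?k - int (?k mod p ^ N)))
        \<ge> ereal (real N)"
      by (intro padic_val_ge_add p)
    then show "padic_val p (x - of_nat (?k mod p ^ N)) \<ge> ereal (real N)" by simp
  qed (use r p0 in auto)
  have sum_d: "(\<Sum>i<N. d i * p ^ i) = r N" for N
  proof (induction N)
    case 0
    show ?case using r(1)[of 0] by simp
  next
    case (Suc N)
    have "r (Suc N) = d N * p ^ N + r (Suc N) mod p ^ N"
      unfolding d_def by (rule div_mult_mod_eq[symmetric])
    then show ?case using Suc r_mod by simp
  qed
  have d: "d i < p" for i
    using r(1)[of "Suc i"] by (simp add: d_def less_mult_imp_div_less)
  have "\<exists>!d. is_padic_expansion p x d"
  proof (rule ex1I[of _ d])
    show "is_padic_expansion p x d"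
      using d r sum_d by (simp add: is_padic_expansion_iff[OF p] del: of_nat_sum)
  next
    fix e assume "is_padic_expansion p x e"
    then have e: "\<And>i. e i < p"
      "\<And>N. padic_val p (x - of_nat (\<Sum>i<N. e i * p ^ i)) \<ge> ereal (real N)"
      by (simp_all add: is_padic_expansion_iff[OF p] del: of_nat_sum)
    have sum_e: "(\<Sum>i<N. e i * p ^ i) = r N" for N
      using padic_residue_unique[OF p digit_sum_less r(1)] e r(2) by blast
    show "e = d"
    proof
      fix i
      \<comment> \<open>Both sides are the difference of the partial sums of lengths
        \<open>i + 1\<close> and \<open>i\<close>, which are residues of \<open>x\<close>.\<close>
      have "e i * p ^ i = d i * p ^ i"
        using sum_e[of "Suc i"] sum_d[of "Suc i"] sum_e[of i] sum_d[of i]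
        unfolding sum.lessThan_Suc by linarith
      then show "e i = d i" using p0 by simp
    qed
  qed
  then show ?thesis unfolding padic_digits_def by (rule theI')
qed

text \<open>This is the residue \<open>x\<^sub>N\<close> of the overview, the representative of
  \<open>x\<close> modulo \<open>p ^ N\<close> in \<open>{0..<p ^ N}\<close>.\<close>

definition padic_trunc :: "nat \<Rightarrow> rat \<Rightarrow> nat \<Rightarrow> nat" where
  "padic_trunc p x N = (\<Sum>i<N. padic_digits p x i * p ^ i)"

lemma padic_trunc_Suc:
  "padic_trunc p x (Suc N) = padic_trunc p x N + padic_digits p x N * p ^ N"
  by (simp add: padic_trunc_def)

context
  fixes p :: nat and x :: rat
  assumes p: "prime p" and x: "padic_val p x \<ge> 0"
begin

lemma padic_digits_less: "padic_digits p x i < p"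
  using is_padic_expansion_padic_digits[OF p x] by (simp add: is_padic_expansion_def)

lemma padic_trunc_less: "padic_trunc p x N < p ^ N"
  unfolding padic_trunc_def by (rule digit_sum_less) (rule padic_digits_less)

lemma padic_val_diff_trunc: "padic_val p (x - of_nat (padic_trunc p x N)) \<ge> ereal (real N)"
  using is_padic_expansion_padic_digits[OF p x]
  unfolding is_padic_expansion_iff[OF p] padic_trunc_def by blast

lemma padic_trunc_eqI:
  assumes "k < p ^ N" "padic_val p (x - of_nat k) \<ge> ereal (real N)"
  shows "padic_trunc p x N = k"
  using padic_residue_unique[OF p padic_trunc_less assms(1) padic_val_diff_trunc assms(2)] .

text \<open>As \<open>x\<close> and its truncation agree modulo \<open>p ^ N\<close>, the valuations
  of the factors \<open>x + i\<close> can be tested by divisibility of natural numbers.\<close>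

lemma power_dvd_trunc_add_iff:
  "p ^ N dvd padic_trunc p x N + i \<longleftrightarrow> padic_val p (x + of_nat i) \<ge> ereal (real N)"
proof -
  let ?t = "padic_trunc p x N"
  have "padic_val p ((x + of_nat i) - of_int (int (?t + i))) \<ge> ereal (real N)"
    using padic_val_diff_trunc[of N] by simp
  then have "padic_val p (x + of_nat i) \<ge> ereal (real N) \<longleftrightarrow> int p ^ N dvd int (?t + i)"
    by (simp only: padic_val_ge_cong[OF p] padic_val_ge_of_int_iff[OF p])
  also have "\<dots> \<longleftrightarrow> p ^ N dvd ?t + i"
    by (metis of_nat_dvd_iff of_nat_power)
  finally show ?thesis by simp
qed

end

lemma padic_val_of_nat_nonneg:
  assumes "prime p"
  shows "padic_val p (of_nat m) \<ge> 0"
  using padic_val_ge_of_int_iff[OF assms, of 0 "int m"] by (simp add: zero_ereal_def)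

lemma padic_trunc_of_nat:
  assumes p: "prime p"
  shows "padic_trunc p (of_nat m) N = m mod p ^ N"
proof (rule padic_trunc_eqI[OF p padic_val_of_nat_nonneg[OF p]])
  show "m mod p ^ N < p ^ N" using p by (simp add: prime_gt_0_nat)
  have "int p ^ N dvd int m - int (m mod p ^ N)"
    by (metis dvd_minus_mod of_nat_diff of_nat_dvd_iff of_nat_power mod_less_eq_dividend)
  then have "padic_val p (of_int (int m - int (m mod p ^ N))) \<ge> ereal (real N)"
    by (simp only: padic_val_ge_of_int_iff[OF p])
  then show "padic_val p (of_nat m - of_nat (m mod p ^ N)) \<ge> ereal (real N)" by simp
qed

lemma padic_digits_of_nat:
  assumes p: "prime p"
  shows "padic_digits p (of_nat m) i = m div p ^ i mod p"
proof -
  have "m mod p ^ Suc i = m mod p ^ i + (m div p ^ i mod p) * p ^ i"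
    using mod_mult2_eq[of m "p ^ i" p] by (simp add: mult.commute)
  then have "(m div p ^ i mod p) * p ^ i = padic_digits p (of_nat m) i * p ^ i"
    using padic_trunc_Suc[of p "of_nat m" i] by (simp add: padic_trunc_of_nat[OF p])
  then show ?thesis using p by (simp add: prime_gt_0_nat)
qed

section \<open>Carries\<close>

lemma carry_le_1: "carry p d e N \<le> 1"
  by (cases N) auto

text \<open>Dividing by \<open>p ^ Suc N\<close> in two stages, first by \<open>p ^ N\<close> and
  then by \<open>p\<close>, reproduces the recursion of \<open>carry\<close>.\<close>

lemma carry_eq_div:
  assumes d: "\<And>i. d i < p" and e: "\<And>i. e i < p"
  shows "carry p d e N = ((\<Sum>i<N. d i * p ^ i) + (\<Sum>i<N. e i * p ^ i)) div p ^ N"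
proof (induction N)
  case (Suc N)
  let ?S = "(\<Sum>i<N. d i * p ^ i) + (\<Sum>i<N. e i * p ^ i)"
  have p0: "p > 0" using d[of 0] by simp
  have "((\<Sum>i<Suc N. d i * p ^ i) + (\<Sum>i<Suc N. e i * p ^ i)) div p ^ Suc N
      = (?S + (d N + e N) * p ^ N) div p ^ N div p"
    by (simp add: div_mult2_eq[symmetric] algebra_simps)
  also have "(?S + (d N + e N) * p ^ N) div p ^ N = carry p d e N + (d N + e N)"
    using p0 Suc by simp
  also have "(carry p d e N + (d N + e N)) div p = carry p d e (Suc N)"
  proof -
    \<comment> \<open>Hence the quotient by \<open>p\<close> is 0 or 1, and it is 1 exactly at the
      threshold in the definition of \<open>carry\<close>.\<close>
    have "carry p d e N + (d N + e N) < 2 * p"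
      using d[of N] e[of N] carry_le_1[of p d e N] by linarith
    then show ?thesis by (auto simp: div_nat_eqI add_ac)
  qed
  finally show ?case by simp
qed simp

text \<open>Split \<open>m\<close> at position \<open>N\<close>: the high part contributes the
  Legendre term \<open>m div p ^ N\<close>, the low part only the carry.\<close>

lemma trunc_add_div_eq:
  assumes p: "prime p" and x: "padic_val p x \<ge> 0"
  shows "(padic_trunc p x N + m) div p ^ N =
    m div p ^ N + carry p (padic_digits p x) (padic_digits p (of_nat m)) N"
proof -
  have "carry p (padic_digits p x) (padic_digits p (of_nat m)) N =
      (padic_trunc p x N + m mod p ^ N) div p ^ N"
    using carry_eq_div[of "padic_digits p x" p "padic_digits p (of_nat m)" N]
      padic_digits_less[OF p x] padic_digits_less[OF p padic_val_of_nat_nonneg[OF p]]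
    by (simp flip: padic_trunc_def add: padic_trunc_of_nat[OF p])
  moreover have "(padic_trunc p x N + m) div p ^ N =
      (padic_trunc p x N + m mod p ^ N + m div p ^ N * p ^ N) div p ^ N"
    by (simp only: add.assoc mod_div_mult_eq)
  ultimately show ?thesis using p by (simp add: prime_gt_0_nat)
qed

text \<open>Legendre's formula with \<open>m!\<close> replaced by \<open>(x + 1)\<^sub>m\<close>; the case \<open>x = 0\<close> is the classical one.\<close>

lemma padic_val_pochhammer:
  assumes p: "prime p" and x: "padic_val p x \<ge> 0"
    and nz: "\<And>i. i \<in> {1..m} \<Longrightarrow> x + of_nat i \<noteq> 0"
    and K: "\<And>i. i \<in> {1..m} \<Longrightarrow> padic_val p (x + of_nat i) \<le> ereal (real K)"
  shows "padic_val p (pochhammer (x + 1) m) =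
    ereal (real (\<Sum>N=1..K. (padic_trunc p x N + m) div p ^ N))"
  using nz K
proof (induction m)
  case 0
  have "padic_trunc p x N div p ^ N = 0" for N
    using padic_trunc_less[OF p x] by simp
  then show ?case by (simp add: zero_ereal_def)
next
  case (Suc m)
  let ?y = "x + of_nat (Suc m)" and ?t = "padic_trunc p x"
  have y0: "?y \<noteq> 0" and yK: "padic_val p ?y \<le> ereal (real K)"
    using Suc.prems(1)[of "Suc m"] Suc.prems(2)[of "Suc m"] by auto
  have "padic_val p ?y \<ge> ereal (real 0)"
    using power_dvd_trunc_add_iff[OF p x, of 0 "Suc m"] by simp
  then obtain a b where nb: "\<not> int p dvd b" and ab: "?y = of_int a / of_int b"
    unfolding padic_val_ge_iff[OF p] by auto
  define w where "w = multiplicity (int p) a"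
  have w: "padic_val p ?y = ereal (real w)"
    using padic_val_of_int_divide[OF p, of a b] nb y0 ab
    by (auto simp: w_def not_dvd_imp_multiplicity_0)
  \<comment> \<open>Increasing the dividend by one raises the quotient exactly when
    \<open>p ^ N\<close> divides the new dividend, that is, when \<open>N\<close> \<le>
    \<open>w\<close>.\<close>
  have "(\<Sum>N=1..K. (?t N + Suc m) div p ^ N) =
      (\<Sum>N=1..K. (?t N + m) div p ^ N + (if N \<le> w then 1 else 0))"
  proof (rule sum.cong)
    fix N
    have "Suc (?t N + m) mod p ^ N = 0 \<longleftrightarrow> N \<le> w"
      using power_dvd_trunc_add_iff[OF p x, of N "Suc m"] w by (simp add: mod_eq_0_iff_dvd)
    then show "(?t N + Suc m) div p ^ N = (?t N + m) div p ^ N + (if N \<le> w then 1 else 0)"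
      by (simp add: div_Suc)
  qed simp
  also have "\<dots> = (\<Sum>N=1..K. (?t N + m) div p ^ N) + card {N\<in>{1..K}. N \<le> w}"
    by (simp add: sum.distrib sum.If_cases Int_def)
  \<comment> \<open>The bound \<open>K\<close> on the valuations ensures that the cut-off loses no
    term.\<close>
  also have "{N\<in>{1..K}. N \<le> w} = {1..w}" using yK w by auto
  finally have "(\<Sum>N=1..K. (?t N + Suc m) div p ^ N) = (\<Sum>N=1..K. (?t N + m) div p ^ N) + w"
    by simp
  moreover have "pochhammer (x + 1) (Suc m) = pochhammer (x + 1) m * ?y"
    by (simp add: pochhammer_Suc add_ac)
  moreover have "padic_val p (pochhammer (x + 1) m) =
      ereal (real (\<Sum>N=1..K. (?t N + m) div p ^ N))"
    using Suc.prems by (intro Suc.IH) auto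
  ultimately show ?case using w by (simp only: padic_val_mult[OF p]) simp
qed

lemma padic_val_pochhammer_over_fact:
  assumes p: "prime p" and x: "padic_val p x \<ge> 0"
  shows "padic_val p (pochhammer (x + 1) m / fact m) = ereal_of_enat (c_p p x (of_nat m))"
proof -
  let ?t = "padic_trunc p x"
  let ?c = "carry p (padic_digits p x) (padic_digits p (of_nat m))"
  have p1: "p > 1" using p by (rule prime_gt_1_nat)
  have m_less: "m < p ^ N" if "m \<le> N" for N
    using power_gt_expt[of p m] power_increasing[OF that, of p] p1
    by (simp del: power_increasing_iff)
  \<comment> \<open>For such \<open>N\<close> the Legendre term of \<open>m\<close> vanishes, so a
    carry means that \<open>?t N + m\<close> reaches \<open>p ^ N\<close>, the only positive
    multiple of it that \<open>?t N + i\<close> with \<open>i\<close> \<le> \<open>m\<close> could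
    meet. This decides the carries far out, in the infinite and in the finite case.\<close>
  have large: "?c N = 1 \<longleftrightarrow> (\<exists>i\<in>{1..m}. padic_val p (x + of_nat i) \<ge> ereal (real N))"
    if "m \<le> N" for N
  proof -
    have tN: "?t N < p ^ N" using padic_trunc_less[OF p x] .
    have "?c N = (?t N + m) div p ^ N"
      using trunc_add_div_eq[OF p x, of N m] m_less[OF that] by simp
    then have "?c N = 1 \<longleftrightarrow> ?t N + m \<ge> p ^ N"
    proof (cases "?t N + m \<ge> p ^ N")
      case True
      then have "(?t N + m) div p ^ N = 1"
        using tN m_less[OF that] by (intro div_nat_eqI) auto
      then show ?thesis using True \<open>?c N = _\<close> by simp
    qed simp
    also have "\<dots> \<longleftrightarrow> (\<exists>i\<in>{1..m}. p ^ N dvd ?t N + i)"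
    proof
      assume "?t N + m \<ge> p ^ N"
      then show "\<exists>i\<in>{1..m}. p ^ N dvd ?t N + i"
        using tN by (intro bexI[of _ "p ^ N - ?t N"]) auto
    next
      assume "\<exists>i\<in>{1..m}. p ^ N dvd ?t N + i"
      then obtain i where "i \<in> {1..m}" "p ^ N dvd ?t N + i" by blast
      then show "?t N + m \<ge> p ^ N"
        using dvd_imp_le[of "p ^ N" "?t N + i"] by auto
    qed
    finally show ?thesis by (simp only: power_dvd_trunc_add_iff[OF p x])
  qed
  show ?thesis
  proof (cases "\<exists>i\<in>{1..m}. x + of_nat i = 0")
    case True
    then obtain i where i: "i \<in> {1..m}" "x + of_nat i = 0" by blast
    \<comment> \<open>The factor of index \<open>i - 1\<close> in the Pochhammer symbol
      vanishes.\<close>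
    have "x + 1 = - of_nat (i - 1)" using i by (simp add: of_nat_diff eq_neg_iff_add_eq_0)
    moreover have "i - 1 < m" using i by auto
    ultimately have "pochhammer (x + 1) m = 0" by (auto simp: pochhammer_eq_0_iff)
    moreover have "infinite {N. ?c N = 1}"
    proof
      assume "finite {N. ?c N = 1}"
      moreover have "{m..} \<subseteq> {N. ?c N = 1}"
      proof
        fix N assume "N \<in> {m..}"
        moreover have "padic_val p (x + of_nat i) \<ge> ereal (real N)" using i(2) by simp
        ultimately show "N \<in> {N. ?c N = 1}" using large[of N] i(1) by blast
      qed
      ultimately show False using infinite_Ici[of m] finite_subset by blast
    qed
    ultimately show ?thesis by (simp add: c_p_def num_carries_def)
  next
    case False
    then have nz: "x + of_nat i \<noteq> 0" if "i \<in> {1..m}" for i using that by blast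
    have "\<exists>K. \<forall>i\<in>{1..m}. padic_val p (x + of_nat i) \<le> ereal (real K)"
    proof -
      have "\<exists>k. padic_val p (x + of_nat i) \<le> ereal (real k)" if "i \<in> {1..m}" for i
        using nz[OF that] real_arch_simple
        by (cases "padic_val p (x + of_nat i)") auto
      then obtain k where k: "\<And>i. i \<in> {1..m} \<Longrightarrow> padic_val p (x + of_nat i) \<le> ereal (real (k i))"
        by metis
      show ?thesis
      proof (intro exI ballI)
        fix i assume i: "i \<in> {1..m}"
        have "k i \<le> (\<Sum>i\<in>{1..m}. k i)" using i by (intro member_le_sum) auto
        then show "padic_val p (x + of_nat i) \<le> ereal (real (\<Sum>i\<in>{1..m}. k i))"
          using k[OF i] by (meson ereal_less_eq(3) of_nat_le_iff order_trans)
      qed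
    qed
    then obtain K0 where K0: "\<And>i. i \<in> {1..m} \<Longrightarrow> padic_val p (x + of_nat i) \<le> ereal (real K0)"
      by blast
    \<comment> \<open>Taking \<open>K\<close> at least \<open>m\<close> gives
      \<open>m < p ^ K\<close>, which also bounds the valuations of 1 to \<open>m\<close>, and makes
      \<open>large\<close> applicable to every \<open>N\<close> beyond \<open>K\<close>.\<close>
    define K where "K = max K0 m"
    have K: "padic_val p (x + of_nat i) \<le> ereal (real K)" if "i \<in> {1..m}" for i
      by (rule order_trans[OF K0[OF that]]) (simp add: K_def)
    have K': "padic_val p (0 + of_nat i) \<le> ereal (real K)" if i: "i \<in> {1..m}" for i
    proof (rule ccontr)
      assume "\<not> ?thesis"
      then have "ereal (real K) \<le> padic_val p (of_int (int i))" by simp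
      then have "int p ^ K dvd int i" by (simp only: padic_val_ge_of_int_iff[OF p])
      then have "p ^ K dvd i" by (metis of_nat_dvd_iff of_nat_power)
      then have "p ^ K \<le> m" using i by (auto dest!: dvd_imp_le)
      then show False using m_less[of K] by (simp add: K_def)
    qed
    have v0: "padic_val p (0 :: rat) \<ge> 0" by simp
    \<comment> \<open>Legendre's formula for \<open>fact m\<close>, with the same cut-off so that
      the two sums can be subtracted termwise.\<close>
    have "padic_val p (pochhammer (0 + 1) m) =
        ereal (real (\<Sum>N=1..K. (padic_trunc p 0 N + m) div p ^ N))"
      by (rule padic_val_pochhammer[OF p v0 _ K']) auto
    then have vfact: "padic_val p (fact m) = ereal (real (\<Sum>N=1..K. m div p ^ N))"
      using padic_trunc_of_nat[OF p, of 0] by (simp flip: pochhammer_fact)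
    have "padic_val p (pochhammer (x + 1) m) =
        ereal (real (\<Sum>N=1..K. (?t N + m) div p ^ N))"
      by (rule padic_val_pochhammer[OF p x nz K])
    also have "(\<Sum>N=1..K. (?t N + m) div p ^ N) = (\<Sum>N=1..K. m div p ^ N) + (\<Sum>N=1..K. ?c N)"
      by (simp add: trunc_add_div_eq[OF p x] sum.distrib)
    finally have vpoch: "padic_val p (pochhammer (x + 1) m / fact m) = ereal (real (\<Sum>N=1..K. ?c N))"
      by (simp add: padic_val_divide[OF p] vfact)
    have sub: "{N. ?c N = 1} \<subseteq> {1..K}"
    proof
      fix N assume N: "N \<in> {N. ?c N = 1}"
      have "N \<le> K"
      proof (rule ccontr)
        assume "\<not> N \<le> K"
        then have "m \<le> N" by (simp add: K_def)
        then obtain i where i: "i \<in> {1..m}" "padic_val p (x + of_nat i) \<ge> ereal (real N)"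
          using N large[of N] by blast
        then have "ereal (real N) \<le> ereal (real K)" using K order_trans by blast
        then show False using \<open>\<not> N \<le> K\<close> by simp
      qed
      moreover have "N \<noteq> 0" using N by (cases N) auto
      ultimately show "N \<in> {1..K}" by simp
    qed
    have "(\<Sum>N=1..K. ?c N) = (\<Sum>N=1..K. if ?c N = 1 then 1 else 0)"
      by (intro sum.cong) (use carry_le_1 in \<open>auto simp: le_Suc_eq\<close>)
    also have "\<dots> = card ({1..K} \<inter> {N. ?c N = 1})" by (simp add: sum.If_cases)
    also have "{1..K} \<inter> {N. ?c N = 1} = {N. ?c N = 1}" using sub by blast
    finally show ?thesis
      using vpoch finite_subset[OF sub] by (simp add: c_p_def num_carries_def)
  qed
qed

section \<open>Periodicity\<close>

text \<open>The equation for \<open>x\<close> says that its expansion consists of the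
  \<open>M\<close> digits of \<open>k\<close> followed by the expansion of \<open>x\<close> itself.
  Comparing truncations of consecutive lengths isolates a single digit.\<close>

lemma padic_digits_add_period:
  assumes p: "prime p" and x: "padic_val p x \<ge> 0"
    and k: "k < p ^ M" and eq: "x = of_nat k + of_nat p ^ M * x"
  shows "padic_digits p x (i + M) = padic_digits p x i"
proof -
  have trunc: "padic_trunc p x (N + M) = k + p ^ M * padic_trunc p x N" for N
  proof (rule padic_trunc_eqI[OF p x])
    have "k + p ^ M * padic_trunc p x N < p ^ M * Suc (padic_trunc p x N)" using k by simp
    also have "\<dots> \<le> p ^ M * p ^ N"
      using padic_trunc_less[OF p x, of N] by (intro mult_left_mono) auto
    finally show "k + p ^ M * padic_trunc p x N < p ^ (N + M)"
      by (simp add: power_add mult.commute)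
    have "x - of_nat (k + p ^ M * padic_trunc p x N) =
        of_nat p ^ M * (x - of_nat (padic_trunc p x N))"
      by (subst eq) (simp add: algebra_simps)
    moreover have "ereal (real M) + ereal (real N) \<le>
        padic_val p (of_nat p ^ M) + padic_val p (x - of_nat (padic_trunc p x N))"
      by (intro add_mono padic_val_diff_trunc[OF p x]) (simp add: padic_val_of_nat_power[OF p])
    ultimately show "padic_val p (x - of_nat (k + p ^ M * padic_trunc p x N)) \<ge> ereal (real (N + M))"
      by (simp only: padic_val_mult[OF p]) (simp add: add.commute)
  qed
  have "p ^ (i + M) * padic_digits p x i = p ^ (i + M) * padic_digits p x (i + M)"
    using trunc[of "Suc i"] trunc[of i] padic_trunc_Suc[of p x "i + M"] padic_trunc_Suc[of p x i]
    by (simp add: algebra_simps power_add)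
  then show ?thesis using p by (simp add: prime_gt_0_nat)
qed

text \<open>Adding the zero digits of \<open>e'\<close> below \<open>M\<close> creates no carry.
  From \<open>M\<close> on, the addition starts afresh with the same digits, because
  \<open>d\<close> is periodic.\<close>

lemma num_carries_shift:
  assumes d: "\<And>i. d i < p" "\<And>i. d (i + M) = d i"
    and e': "\<And>i. i < M \<Longrightarrow> e' i = 0" "\<And>i. e' (i + M) = e i"
  shows "num_carries p d e' = num_carries p d e"
proof -
  \<comment> \<open>Position \<open>M\<close> is included: its incoming carry 0 starts the induction
    for \<open>high\<close>.\<close>
  have low: "carry p d e' i = 0" if "i \<le> M" for i
    using that by (induction i) (use d(1) e' in \<open>auto simp: not_le\<close>)
  have high: "carry p d e' (i + M) = carry p d e i" for i
    by (induction i) (use low d(2) e' in auto)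
  have "{i. carry p d e' i = 1} = (\<lambda>i. i + M) ` {i. carry p d e i = 1}"
  proof (intro equalityI subsetI)
    fix i assume i: "i \<in> {i. carry p d e' i = 1}"
    then have "i > M" using low[of i] by (cases "i \<le> M") auto
    then show "i \<in> (\<lambda>i. i + M) ` {i. carry p d e i = 1}"
      using i high[of "i - M"] by (intro image_eqI[of _ _ "i - M"]) auto
  qed (use high in auto)
  moreover have "inj_on (\<lambda>i. i + M) A" for A :: "nat set" by simp
  ultimately show ?thesis
    by (simp add: num_carries_def finite_image_iff card_image)
qed

lemma c_p_mult_power_period:
  assumes p: "prime p" and x: "padic_val p x \<ge> 0" and "-1 < x" "x < 0"
    and M: "ord (denom x) p dvd M"
  shows "c_p p x (of_nat (m * p ^ M)) = c_p p x (of_nat m)"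
proof -
  obtain a b where ab: "quotient_of x = (a, b)" by (cases "quotient_of x")
  note xab = quotient_of_div[OF ab]
  have b: "b > 0" using ab by (rule quotient_of_denom_pos)
  \<comment> \<open>The order of \<open>p\<close> modulo the denominator divides \<open>M\<close>,
    so \<open>b\<close> divides \<open>p ^ M - 1\<close> and \<open>x\<close> can be written over
    \<open>p ^ M - 1\<close>.\<close>
  have "[p ^ M = 1] (mod nat b)" using M ab by (simp add: ord_divides' denom_def)
  then have "[int (p ^ M) = int 1] (mod int (nat b))" by (simp only: cong_int_iff)
  then have "b dvd int p ^ M - 1" using b by (simp add: cong_iff_dvd_diff)
  then obtain c where c: "int p ^ M - 1 = b * c" by (elim dvdE)
  \<comment> \<open>\<open>x = - k / (p ^ M - 1)\<close>, so the digits of \<open>x\<close> repeat the \<open>M\<close> digits of \<open>k\<close>.\<close>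
  define k where "k = - a * c"
  have "(of_int (b * c) :: rat) = of_int (int p ^ M - 1)" using c by simp
  then have bc: "of_int b * of_int c = (of_nat p ^ M - 1 :: rat)" by simp
  have kx: "of_int k = - x * (of_nat p ^ M - 1)"
    unfolding bc[symmetric] xab k_def using b by simp
  \<comment> \<open>With this, \<open>x < 0\<close> gives \<open>k\<close> \<ge> 0 and
    \<open>-1 < x\<close> gives \<open>k\<close> \<le> \<open>p ^ M - 1\<close>, so \<open>k\<close>
    fits into \<open>M\<close> digits.\<close>
  have pM: "(of_nat p ^ M :: rat) \<ge> 1"
    using prime_ge_1_nat[OF p] by (intro one_le_power) simp
  have "(of_int k :: rat) \<ge> 0"
    unfolding kx using pM \<open>x < 0\<close> by (intro mult_nonneg_nonneg) auto
  then have k0: "k \<ge> 0" by simp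
  have "(of_int k :: rat) \<le> 1 * (of_nat p ^ M - 1)"
    unfolding kx using pM \<open>-1 < x\<close> by (intro mult_right_mono) auto
  then have "(of_int k :: rat) < of_int (int p ^ M)" by simp
  then have "k < int p ^ M" by (simp only: of_int_less_iff)
  then have k1: "nat k < p ^ M" using k0 by (simp add: nat_less_iff)
  have eq: "x = of_nat (nat k) + of_nat p ^ M * x"
    using k0 kx by (simp add: algebra_simps)
  have p0: "p > 0" using p by (rule prime_gt_0_nat)
  show ?thesis unfolding c_p_def
  proof (rule num_carries_shift)
    show "padic_digits p x (i + M) = padic_digits p x i" for i
      by (rule padic_digits_add_period[OF p x k1 eq])
    show "padic_digits p x i < p" for i by (rule padic_digits_less[OF p x])
    show "padic_digits p (of_nat (m * p ^ M)) i = 0" if "i < M" for i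
    proof -
      have "p ^ M = p ^ i * (p * p ^ (M - Suc i))"
        using that by (simp flip: power_Suc power_add)
      then have "m * p ^ M div p ^ i = p * (m * p ^ (M - Suc i))"
        using p0 by (simp add: mult.left_commute[of m])
      then show ?thesis unfolding padic_digits_of_nat[OF p] by simp
    qed
    show "padic_digits p (of_nat (m * p ^ M)) (i + M) = padic_digits p (of_nat m) i" for i
      unfolding padic_digits_of_nat[OF p] using p0 by (simp add: power_add)
  qed
qed

section \<open>Hypergeometric coefficients\<close>

lemma foldl_mult_eq_prod:
  fixes f :: "'a \<Rightarrow> 'b::comm_monoid_mult"
  shows "foldl (\<lambda>r a. r * f a) 1 xs = (\<Prod>i<length xs. f (xs ! i))"
  by (induction xs rule: rev_induct) (simp_all add: nth_append)

text \<open>There is one more upper than lower parameter, so giving every Pochhammer symbol its own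
  \<open>fact m\<close> leaves exactly the one factorial of the series.\<close>

lemma hypergeo_coeff_eq:
  assumes "length \<alpha> = Suc (length \<beta>)"
  shows "hypergeo_coeff \<alpha> \<beta> m =
    (\<Prod>j<length \<alpha>. pochhammer (\<alpha> ! j) m / fact m) / (\<Prod>k<length \<beta>. pochhammer (\<beta> ! k) m / fact m)"
  using assms by (simp add: hypergeo_coeff_def foldl_mult_eq_prod prod_dividef)

section \<open>The carry formula for the coefficients and their periodicity\<close>

theorem theorem3p4:
  fixes n p :: nat and \<alpha> \<beta> :: "rat list"
  assumes "n \<ge> 1" and "length \<alpha> = n" and "length \<beta> = n - 1"
    and "\<forall>k<n - 1. \<beta> ! k \<notin> \<int>\<^sub>\<le>\<^sub>0"
    and "prime p"
    and "\<forall>j<n. padic_val p (\<alpha> ! j - 1) \<ge> 0"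
    and "\<forall>k<n - 1. padic_val p (\<beta> ! k - 1) \<ge> 0"
  shows "(\<forall>m. padic_val p (hypergeo_coeff \<alpha> \<beta> m) =
            (\<Sum>j<n. ereal_of_enat (c_p p (\<alpha> ! j - 1) (of_nat m)))
            - (\<Sum>k<n - 1. ereal_of_enat (c_p p (\<beta> ! k - 1) (of_nat m)))) \<and>
         (admissible \<alpha> \<beta> \<and> good_prime p \<alpha> \<beta> \<longrightarrow>
            (\<forall>m. padic_val p (hypergeo_coeff \<alpha> \<beta> (m * p ^ period p \<alpha> \<beta>)) =
                 padic_val p (hypergeo_coeff \<alpha> \<beta> m)))"
proof -
  note p = \<open>prime p\<close>
  have val: "padic_val p (hypergeo_coeff \<alpha> \<beta> m) =
      (\<Sum>j<n. ereal_of_enat (c_p p (\<alpha> ! j - 1) (of_nat m)))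
      - (\<Sum>k<n - 1. ereal_of_enat (c_p p (\<beta> ! k - 1) (of_nat m)))" for m
  proof -
    have quot: "padic_val p (pochhammer a m / fact m) = ereal_of_enat (c_p p (a - 1) (of_nat m))"
      if "padic_val p (a - 1) \<ge> 0" for a
      using padic_val_pochhammer_over_fact[OF p that, of m] by simp
    \<comment> \<open>A nonzero denominator has finite valuation, so no difference of infinities
      arises.\<close>
    have "pochhammer (\<beta> ! k) m \<noteq> 0" if "k < n - 1" for k
      using assms(4) that by (auto simp: pochhammer_eq_0_iff)
    then have nz: "(\<Prod>k<n - 1. pochhammer (\<beta> ! k) m / fact m) \<noteq> 0" by auto
    have "hypergeo_coeff \<alpha> \<beta> m =
        (\<Prod>j<n. pochhammer (\<alpha> ! j) m / fact m) / (\<Prod>k<n - 1. pochhammer (\<beta> ! k) m / fact m)"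
      using hypergeo_coeff_eq[of \<alpha> \<beta> m] assms(1-3) by simp
    then have "padic_val p (hypergeo_coeff \<alpha> \<beta> m) =
        (\<Sum>j<n. padic_val p (pochhammer (\<alpha> ! j) m / fact m))
        - (\<Sum>k<n - 1. padic_val p (pochhammer (\<beta> ! k) m / fact m))"
      by (simp only: padic_val_divide[OF p nz] padic_val_prod[OF p])
    then show ?thesis using assms(6,7) by (simp add: quot)
  qed
  moreover have "padic_val p (hypergeo_coeff \<alpha> \<beta> (m * p ^ period p \<alpha> \<beta>)) =
      padic_val p (hypergeo_coeff \<alpha> \<beta> m)" if "admissible \<alpha> \<beta>" for m
  proof -
    \<comment> \<open>Admissibility puts \<open>a - 1\<close> strictly between -1 and 0, and the
      order belonging to \<open>a\<close> divides the least common multiple. Every carry count in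
      the formula \<open>val\<close> is therefore unchanged.\<close>
    have "c_p p (a - 1) (of_nat (m * p ^ period p \<alpha> \<beta>)) = c_p p (a - 1) (of_nat m)"
      if a: "a \<in> set \<alpha> \<union> set \<beta>" and "padic_val p (a - 1) \<ge> 0" for a
    proof (rule c_p_mult_power_period[OF p that(2)])
      show "-1 < a - 1" "a - 1 < 0" using \<open>admissible \<alpha> \<beta>\<close> a by (auto simp: admissible_def)
      show "ord (denom (a - 1)) p dvd period p \<alpha> \<beta>"
        unfolding period_def using a by (intro dvd_Lcm) auto
    qed
    then show ?thesis unfolding val using assms(2,3,6,7) by (simp del: of_nat_mult)
  qed
  ultimately show ?thesis by blast
qed

end
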